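(* For all integers $n,r\geq 2$, the path $P_n$ is $(2r,r)$-star colorable.
   Context: $P_n$ denotes the path on $n$ vertices. A star edge coloring of a graph is a proper edge coloring such that no path or cycle with four edges uses at most two colors. For an edge coloring $f$ and a vertex $v$, $A_f(v)$ denotes the set of colors of edges incident to $v$. Two star edge colorings $f_1,f_2$ of $G$ are star compatible if $A_{f_1}(v)\cap A_{f_2}(v)=\emptyset$ for every vertex $v$. $G$ is $(k,t)$-star colorable if $G$ has $t$ pairwise star compatible star edge colorings $f_i:E(G)\to\{0,1,\ldots,k-1\}$, $1\le i\le t$. *)

theory Defs
  imports Main
begin

type_synonym 'a graph = "'a set \<times> 'a set set"

abbreviation verts :: "'a graph \<Rightarrow> 'a set" where "verts G \<equiv> fst G"
abbreviation edges :: "'a graph \<Rightarrow> 'a set set" where "edges G \<equiv> snd G"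

definition simple_graph :: "'a graph \<Rightarrow> bool" where
  "simple_graph G \<longleftrightarrow> finite (verts G) \<and> (\<forall>e\<in>edges G. e \<subseteq> verts G \<and> card e = 2)"

definition path_graph :: "nat \<Rightarrow> nat graph" where
  "path_graph n = ({0..<n}, {{i, Suc i} | i. Suc i < n})"

lemma simple_graph_path_graph: "simple_graph (path_graph n)"
  by (auto simp: simple_graph_def path_graph_def)

definition path_edges :: "'a list \<Rightarrow> 'a set set" where
  "path_edges vs = {{vs ! i, vs ! Suc i} | i. Suc i < length vs}"

text \<open>Paths and cycles of a graph are subgraphs (not necessarily induced), represented here by
  their edge sets.\<close>

definition is_path_in :: "'a graph \<Rightarrow> 'a set set \<Rightarrow> bool" where
  "is_path_in G S \<longleftrightarrow> (\<exists>vs. vs \<noteq> [] \<and> distinct vs \<and> set vs \<subseteq> verts G \<and>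
     S = path_edges vs \<and> S \<subseteq> edges G)"

definition is_cycle_in :: "'a graph \<Rightarrow> 'a set set \<Rightarrow> bool" where
  "is_cycle_in G S \<longleftrightarrow> (\<exists>vs. 3 \<le> length vs \<and> distinct vs \<and> set vs \<subseteq> verts G \<and>
     S = insert {last vs, hd vs} (path_edges vs) \<and> S \<subseteq> edges G)"

definition proper_edge_coloring :: "'a graph \<Rightarrow> ('a set \<Rightarrow> nat) \<Rightarrow> bool" where
  "proper_edge_coloring G f \<longleftrightarrow>
     (\<forall>e\<in>edges G. \<forall>e'\<in>edges G. e \<noteq> e' \<and> e \<inter> e' \<noteq> {} \<longrightarrow> f e \<noteq> f e')"

definition star_edge_coloring :: "'a graph \<Rightarrow> ('a set \<Rightarrow> nat) \<Rightarrow> bool" where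
  "star_edge_coloring G f \<longleftrightarrow> proper_edge_coloring G f \<and>
     \<not> (\<exists>S. (is_path_in G S \<or> is_cycle_in G S) \<and> card S = 4 \<and> card (f ` S) \<le> 2)"

definition colors_at :: "'a graph \<Rightarrow> ('a set \<Rightarrow> nat) \<Rightarrow> 'a \<Rightarrow> nat set" where
  "colors_at G f v = f ` {e \<in> edges G. v \<in> e}"

definition star_compatible :: "'a graph \<Rightarrow> ('a set \<Rightarrow> nat) \<Rightarrow> ('a set \<Rightarrow> nat) \<Rightarrow> bool" where
  "star_compatible G f\<^sub>1 f\<^sub>2 \<longleftrightarrow> (\<forall>v\<in>verts G. colors_at G f\<^sub>1 v \<inter> colors_at G f\<^sub>2 v = {})"

definition star_colorable :: "'a graph \<Rightarrow> nat \<Rightarrow> nat \<Rightarrow> bool" where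
  "star_colorable G k t \<longleftrightarrow> (\<exists>f :: nat \<Rightarrow> 'a set \<Rightarrow> nat.
     (\<forall>i\<in>{1..t}. f i ` edges G \<subseteq> {0..<k} \<and> star_edge_coloring G (f i)) \<and>
     (\<forall>i\<in>{1..t}. \<forall>j\<in>{1..t}. i \<noteq> j \<longrightarrow> star_compatible G (f i) (f j)))"

end

theory Submission
  imports Defs
begin

text \<open>Along the path, the \<open>i\<close>-th coloring uses the constant color \<open>r + i\<close> on the edges in odd
  position, and on the edges in even position it runs through \<open>i, i + 1, i + 2, \<dots>\<close> modulo \<open>r\<close>.
  Since \<open>r \<ge> 2\<close>, two consecutive even edges and the odd edge between them get three distinct
  colors, and any four consecutive edges contain such a triple.\<close>

definition shift_color :: "nat \<Rightarrow> nat \<Rightarrow> nat \<Rightarrow> nat" where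
  "shift_color r i k = (if even k then (i + k div 2) mod r else r + i mod r)"

text \<open>The smaller endpoint of an edge serves as its position, so \<open>Min e\<close> turns a
  coloring of positions into one of edges.\<close>

definition shift_coloring :: "nat \<Rightarrow> nat \<Rightarrow> nat set \<Rightarrow> nat" where
  "shift_coloring r i e = shift_color r i (Min e)"

lemma shift_coloring_edge [simp]: "shift_coloring r i {k, Suc k} = shift_color r i k"
  by (simp add: shift_coloring_def)

lemma edges_path_graph: "edges (path_graph n) = {{i, Suc i} | i. Suc i < n}"
  by (simp add: path_graph_def)

text \<open>Since the index takes the value \<open>r\<close> in the application, the reduction
  \<open>i mod r\<close> matters here: an odd position would otherwise receive
  \<open>2 * r\<close>.\<close>

lemma shift_color_less:
  assumes "r > 0"
  shows "shift_color r i k < 2 * r"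
  using assms mod_less_divisor[of r i] mod_less_divisor[of r "i + k div 2"]
  by (auto simp: shift_color_def simp del: mod_less_divisor)

text \<open>Colors below \<open>r\<close> occur exactly in even positions, whatever the index.
  Taking \<open>i = j\<close> serves properness, distinct indices serve compatibility.\<close>

lemma shift_color_parity:
  assumes "r > 0" "even k \<noteq> even l"
  shows "shift_color r i k \<noteq> shift_color r j l"
proof -
  have "shift_color r i k < r \<longleftrightarrow> even k" for i k
    using assms(1) by (simp add: shift_color_def)
  then show ?thesis using assms(2) by metis
qed

text \<open>The set \<open>{1..r}\<close> represents each residue modulo \<open>r\<close> once: two
  of its elements differ by less than \<open>r\<close>, so a difference divisible by
  \<open>r\<close> is zero.\<close>

lemma mod_add_right_cancel_nat:
  fixes i j m r :: nat
  assumes "i \<in> {1..r}" "j \<in> {1..r}" "(i + m) mod r = (j + m) mod r"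
  shows "i = j"
proof -
  \<comment> \<open>Ordering the two numbers keeps natural subtraction from truncating; the other
    order follows by symmetry.\<close>
  have *: "a = b"
    if "a \<le> b" "a \<in> {1..r}" "b \<in> {1..r}" "(a + m) mod r = (b + m) mod r" for a b
  proof -
    have "r dvd (b + m) - (a + m)"
      by (rule mod_eq_dvd_iff_nat[THEN iffD1, OF _ that(4)[symmetric]]) (use that(1) in simp)
    then have "r dvd b - a" by simp
    moreover have "b - a < r" using that by auto
    ultimately have "b - a = 0" using nat_dvd_not_less by blast
    then show "a = b" using that(1) by simp
  qed
  show ?thesis
    using nat_le_linear[of i j]
  proof
    assume "i \<le> j"
    then show ?thesis using assms by (rule *)
  next
    assume "j \<le> i"
    then show ?thesis using assms(2,1) assms(3)[symmetric] by (rule *[symmetric])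
  qed
qed

text \<open>In either parity the index enters through a residue modulo \<open>r\<close>, shifted by
  \<open>k div 2\<close> in even positions and by 0 in odd ones, so cancellation recovers
  it.\<close>

lemma shift_color_inj:
  assumes "i \<in> {1..r}" "j \<in> {1..r}" "shift_color r i k = shift_color r j k"
  shows "i = j"
  using assms mod_add_right_cancel_nat[of i r j "k div 2"] mod_add_right_cancel_nat[of i r j 0]
  by (auto simp: shift_color_def split: if_splits)

text \<open>Two positions further, \<open>k div 2\<close> grows by one, and consecutive numbers have
  different residues once \<open>r\<close> is at least 2.\<close>

lemma shift_color_even_step:
  assumes "r \<ge> 2" "even k"
  shows "shift_color r i k \<noteq> shift_color r i (Suc (Suc k))"
proof -
  have "x mod r \<noteq> Suc x mod r" for x
    using assms(1) by (auto simp: mod_Suc)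
  then show ?thesis using assms(2) by (simp add: shift_color_def)
qed

lemma card_shift_color_ge_3:
  assumes "r \<ge> 2"
  shows "3 \<le> card (shift_color r i ` {a..a + 3})"
proof -
  \<comment> \<open>This is the first even position of the window; it is at most
    \<open>a + 1\<close>, so \<open>k + 2\<close> still lies inside.\<close>
  define k where "k = (if even a then a else Suc a)"
  have k: "even k" "{k, Suc k, Suc (Suc k)} \<subseteq> {a..a + 3}"
    by (auto simp: k_def)
  have "card (shift_color r i ` {k, Suc k, Suc (Suc k)}) = 3"
    using shift_color_even_step[OF assms k(1)] shift_color_parity[of r k "Suc k" i i]
      shift_color_parity[of r "Suc k" "Suc (Suc k)" i i] assms by simp
  moreover have "shift_color r i ` {k, Suc k, Suc (Suc k)} \<subseteq> shift_color r i ` {a..a + 3}"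
    using k(2) by (rule image_mono)
  ultimately show ?thesis by (metis card_mono finite_atLeastAtMost finite_imageI)
qed

lemma edge_path_graphD:
  assumes "{x, y} \<in> edges (path_graph n)"
  shows "y = Suc x \<or> x = Suc y"
  using assms by (auto simp: edges_path_graph doubleton_eq_iff)

text \<open>Each step changes the vertex by one, and a reversal would revisit the vertex two places
  back; hence the first step fixes the direction. The descending case is written as a sum to avoid
  truncated subtraction.\<close>

lemma path_in_path_graph_monotone:
  assumes "distinct vs" "path_edges vs \<subseteq> edges (path_graph n)"
  shows "(\<forall>i<length vs. vs ! i = vs ! 0 + i) \<or> (\<forall>i<length vs. vs ! 0 = vs ! i + i)"
proof -
  have step: "vs ! Suc i = Suc (vs ! i) \<or> vs ! i = Suc (vs ! Suc i)" if "Suc i < length vs" for i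
  proof -
    have "{vs ! i, vs ! Suc i} \<in> path_edges vs" using that unfolding path_edges_def by blast
    then show ?thesis using assms(2) edge_path_graphD by blast
  qed
  have no_turn: "vs ! i \<noteq> vs ! Suc (Suc i)" if "Suc (Suc i) < length vs" for i
    using that assms(1) by (simp add: nth_eq_iff_index_eq)
  have up: "vs ! Suc i = Suc (vs ! i)" if "vs ! 1 = Suc (vs ! 0)" "Suc i < length vs" for i
    using that(2)
  proof (induction i)
    case (Suc i)
    then show ?case using step[of "Suc i"] no_turn[of i] by auto
  qed (use that(1) in simp)
  have down: "vs ! i = Suc (vs ! Suc i)" if "vs ! 0 = Suc (vs ! 1)" "Suc i < length vs" for i
    using that(2)
  proof (induction i)
    case (Suc i)
    then show ?case using step[of "Suc i"] no_turn[of i] by auto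
  qed (use that(1) in simp)
  consider "length vs \<le> 1" | "vs ! 1 = Suc (vs ! 0)" | "vs ! 0 = Suc (vs ! 1)"
    using step[of 0] by (cases "length vs \<le> 1") auto
  then show ?thesis
  proof cases
    case 1
    then have "\<forall>i<length vs. i = 0" by auto
    then show ?thesis by auto
  next
    case 2
    have "vs ! i = vs ! 0 + i" if "i < length vs" for i
      using that by (induction i) (use up[OF 2] in auto)
    then show ?thesis by blast
  next
    case 3
    have "vs ! 0 = vs ! i + i" if "i < length vs" for i
      using that
    proof (induction i)
      case (Suc i)
      then show ?case using down[OF 3, of i] by simp
    qed simp
    then show ?thesis by blast
  qed
qed

lemma path_edges_image: "path_edges vs = (\<lambda>i. {vs ! i, vs ! Suc i}) ` {i. Suc i < length vs}"
  by (auto simp: path_edges_def)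

lemma card_path_edges_le: "card (path_edges vs) \<le> length vs - 1"
proof -
  have "{i. Suc i < length vs} = {..<length vs - 1}" by auto
  then show ?thesis
    unfolding path_edges_image using card_image_le[of "{..<length vs - 1}"] by simp
qed

text \<open>By monotonicity the ends of the vertex list differ by \<open>length vs - 1\<close>,
  which is at least 2, whereas the closing edge would make them differ by 1.\<close>

lemma path_graph_acyclic: "\<not> is_cycle_in (path_graph n) S"
proof
  assume "is_cycle_in (path_graph n) S"
  then obtain vs where vs: "3 \<le> length vs" "distinct vs"
    "S = insert {last vs, hd vs} (path_edges vs)" "S \<subseteq> edges (path_graph n)"
    by (auto simp: is_cycle_in_def)
  have "vs \<noteq> []" using vs(1) by auto
  then have "last vs = vs ! (length vs - 1)" "hd vs = vs ! 0"
    by (simp_all add: last_conv_nth hd_conv_nth)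
  then have "{vs ! (length vs - 1), vs ! 0} \<in> edges (path_graph n)" using vs(3,4) by auto
  then have "vs ! 0 = Suc (vs ! (length vs - 1)) \<or> vs ! (length vs - 1) = Suc (vs ! 0)"
    by (rule edge_path_graphD)
  moreover have "length vs - 1 < length vs" using vs(1) by simp
  then have "vs ! (length vs - 1) = vs ! 0 + (length vs - 1)
      \<or> vs ! 0 = vs ! (length vs - 1) + (length vs - 1)"
    using path_in_path_graph_monotone[OF vs(2), of n] vs(3,4) by blast
  ultimately show False using vs(1) by linarith
qed

text \<open>Four edges force at least five vertices, and by monotonicity the first four edges of the
  list fill a window of consecutive positions.\<close>

lemma path_in_path_graph_consecutive:
  assumes "is_path_in (path_graph n) S" "card S = 4"
  obtains a where "(\<lambda>k. {k, Suc k}) ` {a..a + 3} \<subseteq> S"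
proof -
  obtain vs where vs: "distinct vs" "S = path_edges vs" "S \<subseteq> edges (path_graph n)"
    using assms(1) by (auto simp: is_path_in_def)
  have len: "5 \<le> length vs"
    using assms(2) card_path_edges_le[of vs] vs(2) by simp
  have S: "{vs ! i, vs ! Suc i} \<in> S" if "i \<le> 3" for i
    using that len by (auto simp: vs(2) path_edges_def)
  consider (up) "\<forall>i<length vs. vs ! i = vs ! 0 + i" | (down) "\<forall>i<length vs. vs ! 0 = vs ! i + i"
    using path_in_path_graph_monotone[OF vs(1), of n] vs(2,3) by blast
  then show thesis
  proof cases
    case up
    have "{k, Suc k} \<in> S" if "k \<in> {vs ! 0..vs ! 0 + 3}" for k
    proof -
      define i where "i = k - vs ! 0"
      have "i \<le> 3" "vs ! i = k" "vs ! Suc i = Suc k"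
        using that len up[rule_format, of i] up[rule_format, of "Suc i"] by (auto simp: i_def)
      then show ?thesis using S[of i] by simp
    qed
    then show thesis by (intro that[of "vs ! 0"]) blast
  next
    case down
    have four: "vs ! 0 = vs ! 4 + 4" using down len by simp
    have "{k, Suc k} \<in> S" if "k \<in> {vs ! 4..vs ! 4 + 3}" for k
    proof -
      \<comment> \<open>On a descending list the window starts at \<open>vs ! 4\<close>, and the
        edge in position \<open>k\<close> is found by counting backwards.\<close>
      define i where "i = vs ! 4 + 3 - k"
      have i: "i \<le> 3" "k + i = vs ! 4 + 3"
        using that by (auto simp: i_def)
      moreover have "vs ! 0 = vs ! i + i" "vs ! 0 = vs ! Suc i + Suc i"
        using down[rule_format, of i] down[rule_format, of "Suc i"] len i(1) by linarith+
      ultimately have "vs ! i = Suc k" "vs ! Suc i = k"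
        using four by linarith+
      then show ?thesis using S[OF i(1)] by (simp add: insert_commute)
    qed
    then show thesis by (intro that[of "vs ! 4"]) blast
  qed
qed

text \<open>Distinct edges with a common vertex have adjacent positions, hence opposite parity.
  There are no cycles, and a path with four edges contains a window that already shows three
  colors.\<close>

lemma star_edge_coloring_shift:
  assumes "r \<ge> 2"
  shows "star_edge_coloring (path_graph n) (shift_coloring r i)"
  unfolding star_edge_coloring_def
proof
  show "proper_edge_coloring (path_graph n) (shift_coloring r i)"
    unfolding proper_edge_coloring_def
  proof (intro ballI impI)
    fix e e' assume "e \<in> edges (path_graph n)" "e' \<in> edges (path_graph n)"
      and ne: "e \<noteq> e' \<and> e \<inter> e' \<noteq> {}"
    then obtain k l where kl: "e = {k, Suc k}" "e' = {l, Suc l}"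
      by (auto simp: edges_path_graph)
    then have "l = Suc k \<or> k = Suc l" using ne by auto
    then have "even k \<noteq> even l" by auto
    then show "shift_coloring r i e \<noteq> shift_coloring r i e'"
      using shift_color_parity assms by (simp add: kl)
  qed
  show "\<not> (\<exists>S. (is_path_in (path_graph n) S \<or> is_cycle_in (path_graph n) S) \<and>
      card S = 4 \<and> card (shift_coloring r i ` S) \<le> 2)"
  proof
    assume "\<exists>S. (is_path_in (path_graph n) S \<or> is_cycle_in (path_graph n) S) \<and>
      card S = 4 \<and> card (shift_coloring r i ` S) \<le> 2"
    then obtain S where S: "is_path_in (path_graph n) S" "card S = 4"
      "card (shift_coloring r i ` S) \<le> 2"
      using path_graph_acyclic by blast
    obtain a where a: "(\<lambda>k. {k, Suc k}) ` {a..a + 3} \<subseteq> S"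
      using path_in_path_graph_consecutive S(1,2) .
    have "shift_color r i ` {a..a + 3} = shift_coloring r i ` (\<lambda>k. {k, Suc k}) ` {a..a + 3}"
      by (simp add: image_image)
    also have "\<dots> \<subseteq> shift_coloring r i ` S" using a by (rule image_mono)
    finally have "card (shift_color r i ` {a..a + 3}) \<le> card (shift_coloring r i ` S)"
      \<comment> \<open>The positive cardinality of \<open>S\<close> supplies the finiteness that
        monotonicity of \<open>card\<close> requires.\<close>
      using S(2) by (intro card_mono finite_imageI card_ge_0_finite) simp
    then show False using card_shift_color_ge_3[OF assms, of i a] S(3) by linarith
  qed
qed

text \<open>A common color forces equal parity of the two positions. Edges at the same vertex have
  positions at most one apart, so the positions coincide, and there the color determines the
  index.\<close>

lemma star_compatible_shift:
  assumes "i \<in> {1..r}" "j \<in> {1..r}" "i \<noteq> j"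
  shows "star_compatible (path_graph n) (shift_coloring r i) (shift_coloring r j)"
  unfolding star_compatible_def
proof (intro ballI equals0I)
  fix v c
  assume "c \<in> colors_at (path_graph n) (shift_coloring r i) v
    \<inter> colors_at (path_graph n) (shift_coloring r j) v"
  then obtain e e' where e: "e \<in> edges (path_graph n)" "e' \<in> edges (path_graph n)"
    "v \<in> e" "v \<in> e'" "shift_coloring r i e = shift_coloring r j e'"
    unfolding colors_at_def by blast
  then obtain k l where "e = {k, Suc k}" "e' = {l, Suc l}"
    unfolding edges_path_graph by blast
  with e have kl: "v \<in> {k, Suc k}" "v \<in> {l, Suc l}" "shift_color r i k = shift_color r j l"
    by simp_all
  then have "even k = even l" using shift_color_parity[of r k l i j] assms(1) by auto
  then have "k = l" using kl(1,2) by auto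
  then show False using shift_color_inj kl(3) assms by blast
qed

theorem theorem4:
  fixes n r :: nat
  assumes "n \<ge> 2" and "r \<ge> 2"
  shows "star_colorable (path_graph n) (2 * r) r"
proof -
  have "shift_coloring r i ` edges (path_graph n) \<subseteq> {0..<2 * r}" for i
  proof (rule image_subsetI)
    fix e assume "e \<in> edges (path_graph n)"
    then obtain k where "e = {k, Suc k}"
      unfolding edges_path_graph by blast
    then show "shift_coloring r i e \<in> {0..<2 * r}"
      using shift_color_less[of r i k] assms(2) by simp
  qed
  moreover have "star_edge_coloring (path_graph n) (shift_coloring r i)" for i
    using assms(2) by (rule star_edge_coloring_shift)
  ultimately have "(\<forall>i\<in>{1..r}. shift_coloring r i ` edges (path_graph n) \<subseteq> {0..<2 * r} \<and>
      star_edge_coloring (path_graph n) (shift_coloring r i)) \<and>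
    (\<forall>i\<in>{1..r}. \<forall>j\<in>{1..r}. i \<noteq> j \<longrightarrow>
      star_compatible (path_graph n) (shift_coloring r i) (shift_coloring r j))"
    by (intro conjI ballI impI star_compatible_shift)
  then show ?thesis
    unfolding star_colorable_def by (rule exI[of _ "shift_coloring r"])
qed

end
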